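(* The conformal $2$-forms of the Reissner-Nordström-de Sitter (RNdS) spacetime with parameters $M,e,\Lambda$ (metric as in the context) are recurrent: there is a $1$-form $\sigma$ such that, for all vector fields $X_1,\dots,X_5$, $$\mathop{\mathcal S}_{X_1,X_2,X_3}(\nabla_{X_1}C)(X_2,X_3,X_4,X_5)=\mathop{\mathcal S}_{X_1,X_2,X_3}\sigma(X_1)\,C(X_2,X_3,X_4,X_5),$$ where $\mathcal S_{X_1,X_2,X_3}$ denotes the cyclic sum over $X_1,X_2,X_3$ and $C$ is the conformal (Weyl) curvature tensor of type $(0,4)$.
   Context: $M$ (mass), $e\neq0$ (electric charge) and $\Lambda>0$ (cosmological constant) are constants, $f(r)=1-\frac{2M}{r}+\frac{e^2}{r^2}-\Lambda r^2$, and in coordinates $(t,r,\theta,\phi)$ the RNdS metric is $g=-f\,dt^2+f^{-1}dr^2+r^2(d\theta^2+\sin^2\theta\,d\phi^2)$. $\nabla$ is the Levi-Civita connection of $g$. The curvature $2$-forms associated with a $(0,4)$ tensor $B$ are called recurrent if the displayed identity holds with $B$ in place of $C$ for some $1$-form $\sigma$; the conformal $2$-forms are those associated with $C$.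
   Formalization: The hypersurface Mr = e² is removed from the coordinate domain (r > 0, f ≠ 0, 0 < θ < π): there C = 0, but the cyclic sum of ∇C is nonzero (coefficient 2e²/r⁵), so no 1-form σ can satisfy the identity at those points. *)

theory Defs
  imports "HOL-Analysis.Analysis"
begin

text \<open>
  Semi-Riemannian geometry in one coordinate chart.  A point is its coordinate vector in
  \<open>real ^ 'n\<close>; a metric, vector field, 1-form or \<open>(0,k)\<close> tensor field is given by its components
  in the coordinate frame.
\<close>

type_synonym 'n metric = "real ^ 'n \<Rightarrow> real ^ 'n ^ 'n"
type_synonym 'n vector_field = "real ^ 'n \<Rightarrow> real ^ 'n"
type_synonym 'n one_form = "real ^ 'n \<Rightarrow> 'n \<Rightarrow> real"
type_synonym 'n tensor02 = "real ^ 'n \<Rightarrow> 'n \<Rightarrow> 'n \<Rightarrow> real"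
type_synonym 'n tensor04 = "real ^ 'n \<Rightarrow> 'n \<Rightarrow> 'n \<Rightarrow> 'n \<Rightarrow> 'n \<Rightarrow> real"
type_synonym 'n tensor05 = "real ^ 'n \<Rightarrow> 'n \<Rightarrow> 'n \<Rightarrow> 'n \<Rightarrow> 'n \<Rightarrow> 'n \<Rightarrow> real"


definition partial_deriv :: "'n::finite \<Rightarrow> (real ^ 'n \<Rightarrow> real) \<Rightarrow> real ^ 'n \<Rightarrow> real" where
  "partial_deriv i f p = deriv (\<lambda>s. f (p + s *\<^sub>R axis i 1)) 0"

text \<open>
  Smoothness is only meaningful for open \<open>U\<close>; values of \<open>f\<close> off \<open>U\<close> are then irrelevant.
\<close>

primrec Ck_on :: "nat \<Rightarrow> (real ^ 'n::finite) set \<Rightarrow> (real ^ 'n \<Rightarrow> real) \<Rightarrow> bool" where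
  "Ck_on 0 U f \<longleftrightarrow> continuous_on U f"
| "Ck_on (Suc k) U f \<longleftrightarrow>
     (\<forall>p\<in>U. f differentiable (at p)) \<and> (\<forall>i. Ck_on k U (partial_deriv i f))"

definition smooth_on :: "(real ^ 'n::finite) set \<Rightarrow> (real ^ 'n \<Rightarrow> real) \<Rightarrow> bool" where
  "smooth_on U f \<longleftrightarrow> (\<forall>k. Ck_on k U f)"

definition smooth_vector_field :: "(real ^ 'n::finite) set \<Rightarrow> 'n vector_field \<Rightarrow> bool" where
  "smooth_vector_field U X \<longleftrightarrow> (\<forall>i. smooth_on U (\<lambda>p. X p $ i))"

definition smooth_one_form :: "(real ^ 'n::finite) set \<Rightarrow> 'n one_form \<Rightarrow> bool" where
  "smooth_one_form U \<sigma> \<longleftrightarrow> (\<forall>i. smooth_on U (\<lambda>p. \<sigma> p i))"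


definition inv_metric :: "'n::finite metric \<Rightarrow> 'n metric" where
  "inv_metric g p = matrix_inv (g p)"

text \<open>\<open>christoffel g p k i j\<close> is the component \<open>\<Gamma>\<^sup>k\<^sub>i\<^sub>j\<close> of the Levi-Civita connection.\<close>

definition christoffel :: "'n::finite metric \<Rightarrow> real ^ 'n \<Rightarrow> 'n \<Rightarrow> 'n \<Rightarrow> 'n \<Rightarrow> real" where
  "christoffel g p k i j =
     (1/2) * (\<Sum>l\<in>UNIV. inv_metric g p $ k $ l *
       (partial_deriv i (\<lambda>q. g q $ j $ l) p
        + partial_deriv j (\<lambda>q. g q $ i $ l) p
        - partial_deriv l (\<lambda>q. g q $ i $ j) p))"

text \<open>
  \<open>riemann_endo g p l k i j\<close> is the \<open>l\<close>-th component of \<open>R(\<partial>\<^sub>i, \<partial>\<^sub>j) \<partial>\<^sub>k\<close>, where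
  \<open>R(X, Y) Z = \<nabla>\<^sub>X \<nabla>\<^sub>Y Z - \<nabla>\<^sub>Y \<nabla>\<^sub>X Z - \<nabla>\<^bsub>[X, Y]\<^esub> Z\<close>.  The \<open>(0,4)\<close> tensor is
  \<open>R(X, Y, Z, W) = g(R(X, Y) Z, W)\<close>, and \<open>Ric(Y, Z)\<close> is the trace of \<open>X \<mapsto> R(X, Y) Z\<close>.
\<close>

definition riemann_endo ::
    "'n::finite metric \<Rightarrow> real ^ 'n \<Rightarrow> 'n \<Rightarrow> 'n \<Rightarrow> 'n \<Rightarrow> 'n \<Rightarrow> real" where
  "riemann_endo g p l k i j =
     partial_deriv i (\<lambda>q. christoffel g q l j k) p
     - partial_deriv j (\<lambda>q. christoffel g q l i k) p
     + (\<Sum>m\<in>UNIV. christoffel g p l i m * christoffel g p m j k)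
     - (\<Sum>m\<in>UNIV. christoffel g p l j m * christoffel g p m i k)"

definition riemann :: "'n::finite metric \<Rightarrow> 'n tensor04" where
  "riemann g p i j k l = (\<Sum>m\<in>UNIV. riemann_endo g p m k i j * g p $ m $ l)"

definition ricci :: "'n::finite metric \<Rightarrow> 'n tensor02" where
  "ricci g p j k = (\<Sum>i\<in>UNIV. riemann_endo g p i k i j)"

definition scalar_curvature :: "'n::finite metric \<Rightarrow> real ^ 'n \<Rightarrow> real" where
  "scalar_curvature g p = (\<Sum>j\<in>UNIV. \<Sum>k\<in>UNIV. inv_metric g p $ j $ k * ricci g p j k)"

text \<open>
  The sign of the Kulkarni-Nomizu product matches the sign of \<open>riemann\<close>: constant curvature
  \<open>\<kappa>\<close> means \<open>R = (\<kappa>/2) (g \<and> g)\<close>.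
\<close>

definition kulkarni_nomizu :: "'n::finite tensor02 \<Rightarrow> 'n tensor02 \<Rightarrow> 'n tensor04" where
  "kulkarni_nomizu A E p i j k l =
     A p i l * E p j k + A p j k * E p i l - A p i k * E p j l - A p j l * E p i k"

abbreviation metric_tensor :: "'n::finite metric \<Rightarrow> 'n tensor02" where
  "metric_tensor g \<equiv> (\<lambda>p i j. g p $ i $ j)"

text \<open>Weyl tensor in dimension \<open>CARD('n) \<ge> 3\<close>.\<close>

definition weyl :: "'n::finite metric \<Rightarrow> 'n tensor04" where
  "weyl g p i j k l =
     riemann g p i j k l
     - kulkarni_nomizu (metric_tensor g) (ricci g) p i j k l / (real CARD('n) - 2)
     + scalar_curvature g p / (2 * (real CARD('n) - 1) * (real CARD('n) - 2))
       * kulkarni_nomizu (metric_tensor g) (metric_tensor g) p i j k l"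

text \<open>\<open>nabla g B p m i j k l\<close> is \<open>(\<nabla>\<^bsub>\<partial>\<^sub>m\<^esub> B)(\<partial>\<^sub>i, \<partial>\<^sub>j, \<partial>\<^sub>k, \<partial>\<^sub>l)\<close> at \<open>p\<close>.\<close>

definition nabla :: "'n::finite metric \<Rightarrow> 'n tensor04 \<Rightarrow> 'n tensor05" where
  "nabla g B p m i j k l =
     partial_deriv m (\<lambda>q. B q i j k l) p
     - (\<Sum>s\<in>UNIV. christoffel g p s m i * B p s j k l)
     - (\<Sum>s\<in>UNIV. christoffel g p s m j * B p i s k l)
     - (\<Sum>s\<in>UNIV. christoffel g p s m k * B p i j s l)
     - (\<Sum>s\<in>UNIV. christoffel g p s m l * B p i j k s)"


definition eval1 :: "'n::finite one_form \<Rightarrow> real ^ 'n \<Rightarrow> real ^ 'n \<Rightarrow> real" where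
  "eval1 \<sigma> p u = (\<Sum>i\<in>UNIV. \<sigma> p i * u $ i)"

definition eval4 ::
    "'n::finite tensor04 \<Rightarrow> real ^ 'n \<Rightarrow> real ^ 'n \<Rightarrow> real ^ 'n \<Rightarrow> real ^ 'n \<Rightarrow> real ^ 'n \<Rightarrow> real" where
  "eval4 B p u v w x =
     (\<Sum>i\<in>UNIV. \<Sum>j\<in>UNIV. \<Sum>k\<in>UNIV. \<Sum>l\<in>UNIV.
        B p i j k l * u $ i * v $ j * w $ k * x $ l)"

definition eval5 ::
    "'n::finite tensor05 \<Rightarrow> real ^ 'n \<Rightarrow> real ^ 'n \<Rightarrow> real ^ 'n \<Rightarrow> real ^ 'n \<Rightarrow> real ^ 'n
      \<Rightarrow> real ^ 'n \<Rightarrow> real" where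
  "eval5 T p t u v w x =
     (\<Sum>m\<in>UNIV. \<Sum>i\<in>UNIV. \<Sum>j\<in>UNIV. \<Sum>k\<in>UNIV. \<Sum>l\<in>UNIV.
        T p m i j k l * t $ m * u $ i * v $ j * w $ k * x $ l)"

definition cyclic_sum :: "('v \<Rightarrow> 'v \<Rightarrow> 'v \<Rightarrow> real) \<Rightarrow> 'v \<Rightarrow> 'v \<Rightarrow> 'v \<Rightarrow> real" where
  "cyclic_sum F x y z = F x y z + F y z x + F z x y"

definition recurrent_curvature_two_forms ::
    "'n::finite metric \<Rightarrow> 'n tensor04 \<Rightarrow> (real ^ 'n) set \<Rightarrow> bool" where
  "recurrent_curvature_two_forms g B U \<longleftrightarrow>
     (\<exists>\<sigma>. smooth_one_form U \<sigma> \<and>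
       (\<forall>X1 X2 X3 X4 X5.
          smooth_vector_field U X1 \<longrightarrow> smooth_vector_field U X2 \<longrightarrow> smooth_vector_field U X3 \<longrightarrow>
          smooth_vector_field U X4 \<longrightarrow> smooth_vector_field U X5 \<longrightarrow>
          (\<forall>p\<in>U.
             cyclic_sum (\<lambda>Y1 Y2 Y3. eval5 (nabla g B) p (Y1 p) (Y2 p) (Y3 p) (X4 p) (X5 p))
               X1 X2 X3
             = cyclic_sum (\<lambda>Y1 Y2 Y3. eval1 \<sigma> p (Y1 p) * eval4 B p (Y2 p) (Y3 p) (X4 p) (X5 p))
                 X1 X2 X3)))"

definition recurrent_conformal_two_forms :: "'n::finite metric \<Rightarrow> (real ^ 'n) set \<Rightarrow> bool" where
  "recurrent_conformal_two_forms g U \<longleftrightarrow> recurrent_curvature_two_forms g (weyl g) U"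


text \<open>The coordinates \<open>(t, r, \<theta>, \<phi>)\<close> are the components \<open>1, 2, 3, 4\<close> of \<open>real ^ 4\<close>.\<close>

definition rnds_f :: "real \<Rightarrow> real \<Rightarrow> real \<Rightarrow> real \<Rightarrow> real" where
  "rnds_f M e \<Lambda> r = 1 - 2 * M / r + e\<^sup>2 / r\<^sup>2 - \<Lambda> * r\<^sup>2"

definition rnds_metric :: "real \<Rightarrow> real \<Rightarrow> real \<Rightarrow> 4 metric" where
  "rnds_metric M e \<Lambda> p = (\<chi> i j.
     if i \<noteq> j then 0
     else if i = 1 then - rnds_f M e \<Lambda> (p $ 2)
     else if i = 2 then 1 / rnds_f M e \<Lambda> (p $ 2)
     else if i = 3 then (p $ 2)\<^sup>2
     else (p $ 2)\<^sup>2 * (sin (p $ 3))\<^sup>2)"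

text \<open>
  Where the coordinate expression is a nondegenerate metric.  Both signs of \<open>f\<close> are allowed, and
  \<open>\<phi>\<close> is not restricted to one period, since the metric does not depend on it.
\<close>

definition rnds_chart :: "real \<Rightarrow> real \<Rightarrow> real \<Rightarrow> (real ^ 4) set" where
  "rnds_chart M e \<Lambda> =
     {p. 0 < p $ 2 \<and> rnds_f M e \<Lambda> (p $ 2) \<noteq> 0 \<and> 0 < p $ 3 \<and> p $ 3 < pi}"

text \<open>
  All components of the Weyl tensor carry the factor \<open>M r - e\<^sup>2\<close>, and the recurrence form is
  \<open>\<sigma> = e\<^sup>2 / (r (M r - e\<^sup>2)) dr\<close>.  On the hypersurface \<open>M r = e\<^sup>2\<close> (empty if \<open>M \<le> 0\<close>) the Weyl tensor
  vanishes but the cyclic sum of its covariant derivative does not, so no 1-form can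
  satisfy the recurrence identity there.  It is therefore removed, leaving the points of the chart
  where the Weyl tensor is nonzero.
\<close>

definition rnds_regular_chart :: "real \<Rightarrow> real \<Rightarrow> real \<Rightarrow> (real ^ 4) set" where
  "rnds_regular_chart M e \<Lambda> = {p \<in> rnds_chart M e \<Lambda>. M * p $ 2 \<noteq> e\<^sup>2}"

end

theory Submission
  imports Defs "HOL-Computational_Algebra.Polynomial"
begin

text \<open>
  The RNdS metric is a warped product of the \<open>(t, r)\<close> plane and the round sphere of radius \<open>r\<close>, so
  every coordinate plane is an eigenplane of the curvature operator:
  \<open>R\<^sub>i\<^sub>j\<^sub>k\<^sub>l = K\<^sub>i\<^sub>j (g\<^sub>i\<^sub>l g\<^sub>j\<^sub>k - g\<^sub>j\<^sub>l g\<^sub>i\<^sub>k)\<close>, where the sectional curvature \<open>K\<^sub>i\<^sub>j\<close> takes only three values, for the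
  \<open>(t, r)\<close> plane, for the spherical plane, and for the four mixed planes (\<open>riemann_endo_rnds\<close>).
  The Weyl tensor inherits this diagonal form.  Being trace free, it has a single free function
  \<open>w\<close>: the eigenvalue is \<open>w\<close> on the two pure planes and \<open>- w / 2\<close> on the mixed ones, and for the
  RNdS function \<open>f\<close> one finds \<open>w = 2 (M r - e\<^sup>2) / r\<^sup>4\<close> (\<open>weyl_rnds\<close>).  Hence \<open>C = w B\<close> with a tensor \<open>B\<close>
  that is built from the metrics of the two factors.

  Covariant differentiation of \<open>B\<close> only sees how the two factors rotate into each other, which the
  warping function \<open>r\<close> governs through the coefficient \<open>1 / r\<close>.  After cyclic summation the effect
  is the same as multiplication by \<open>3 dr / r\<close>, so that the cyclic sum of \<open>\<nabla>C\<close> is the cyclic sum of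
  \<open>(w' + 3 w / r) dr\<close> times \<open>B\<close> (\<open>cyclic_nabla_weyl_rnds\<close>).  Without charge \<open>w\<close> is a multiple of \<open>1 / r\<^sup>3\<close>
  and the sum vanishes, as the second Bianchi identity demands in an Einstein space.  In general
  \<open>w' + 3 w / r = 2 e\<^sup>2 / r\<^sup>5\<close>, and wherever \<open>w \<noteq> 0\<close> the quotient by \<open>w\<close> gives the recurrence form
  \<open>\<sigma> = e\<^sup>2 / (r (M r - e\<^sup>2)) dr\<close>.

  The coordinate computation is kept small by two reductions.  An identity between multilinear
  cyclic sums only has to be checked on components (\<open>recurrent_curvature_two_formsI\<close>), and by
  antisymmetry only for the four increasing triples of indices (\<open>alternating_cyclic_sum_4\<close>).
\<close>

section \<open>Partial derivatives and smooth functions\<close>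

lemma partial_deriv_cong:
  fixes U :: "(real ^ 'n::finite) set"
  assumes "open U" "p \<in> U" "\<And>q. q \<in> U \<Longrightarrow> f q = g q"
  shows "partial_deriv i f p = partial_deriv i g p"
proof -
  have "((\<lambda>s::real. p + s *\<^sub>R axis i 1) \<longlongrightarrow> p + 0 *\<^sub>R axis i 1) (nhds 0)"
    by (intro tendsto_intros) (auto simp: filterlim_ident)
  then have "eventually (\<lambda>s. p + s *\<^sub>R axis i 1 \<in> U) (nhds 0)"
    using assms(1,2) by (auto dest: topological_tendstoD)
  then show ?thesis
    unfolding partial_deriv_def by (intro deriv_cong_ev) (auto elim!: eventually_mono simp: assms(3))
qed

lemma deriv_shift_0: "deriv (\<lambda>s. h (x + s)) 0 = deriv h (x :: real)"
  unfolding deriv_def using DERIV_shift[of h _ 0 x] by (simp add: add.commute)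

text \<open>
  No differentiability is assumed: both sides are values of \<open>deriv\<close> for functions that differ by a
  translation of the argument.
\<close>

lemma partial_deriv_plane:
  "partial_deriv i (\<lambda>q. F (q $ 2) (q $ 3)) (p :: real ^ 4) =
     (if i = 2 then deriv (\<lambda>r. F r (p $ 3)) (p $ 2)
      else if i = 3 then deriv (\<lambda>\<theta>. F (p $ 2) \<theta>) (p $ 3) else 0)"
  using exhaust_4[of i] deriv_shift_0[of "\<lambda>r. F r (p $ 3)" "p $ 2"]
    deriv_shift_0[of "\<lambda>\<theta>. F (p $ 2) \<theta>" "p $ 3"]
  by (auto simp: partial_deriv_def axis_def)

lemma Ck_on_cong:
  assumes "open U" "\<And>q. q \<in> U \<Longrightarrow> f q = g q" "Ck_on k U f"
  shows "Ck_on k U g"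
  using assms(2,3)
proof (induction k arbitrary: f g)
  case 0
  then show ?case using continuous_on_cong by (metis Ck_on.simps(1))
next
  case (Suc k)
  have "g differentiable (at p)" if "p \<in> U" for p
  proof -
    obtain D where "(f has_derivative D) (at p)"
      using Suc.prems(2) \<open>p \<in> U\<close> unfolding Ck_on.simps differentiable_def by blast
    then have "(g has_derivative D) (at p)"
      using has_derivative_transform_within_open[OF _ assms(1) that] Suc.prems(1) by blast
    then show ?thesis unfolding differentiable_def by blast
  qed
  moreover have "Ck_on k U (partial_deriv i g)" for i
  proof (rule Suc.IH)
    show "partial_deriv i f q = partial_deriv i g q" if "q \<in> U" for q
      by (rule partial_deriv_cong[OF assms(1) that Suc.prems(1)])
    show "Ck_on k U (partial_deriv i f)" using Suc.prems(2) by simp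
  qed
  ultimately show ?case by simp
qed

text \<open>
  The functions \<open>P / Q\<^sup>n\<close> with \<open>Q\<close> fixed are closed under differentiation, so the induction on the order
  of smoothness runs over all of them at once.
\<close>

lemma smooth_on_rational:
  fixes P Q :: "real poly"
  assumes U: "open U" and Q: "\<And>p. p \<in> U \<Longrightarrow> poly Q (p $ i) \<noteq> 0"
  shows "smooth_on U (\<lambda>p :: real ^ 'n::finite. poly P (p $ i) / poly Q (p $ i))"
proof -
  have der: "((\<lambda>x. poly P x / poly Q x ^ n) has_field_derivative
      poly (pderiv P * Q - of_nat n * P * pderiv Q) x / poly Q x ^ Suc n) (at x)"
    if "poly Q x \<noteq> 0" for P n x
  proof -
    have "((\<lambda>x. poly P x / poly Q x ^ n) has_field_derivative
        (poly (pderiv P) x * poly Q x ^ n - poly P x * (of_nat n * (poly (pderiv Q) x * poly Q x ^ (n - 1))))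
          / (poly Q x ^ n * poly Q x ^ n)) (at x)"
      using that by (intro DERIV_divide poly_DERIV DERIV_cong[OF DERIV_power[OF poly_DERIV[of Q x], of n]]) simp_all
    also have "(poly (pderiv P) x * poly Q x ^ n - poly P x * (of_nat n * (poly (pderiv Q) x * poly Q x ^ (n - 1))))
          / (poly Q x ^ n * poly Q x ^ n) =
        poly (pderiv P * Q - of_nat n * P * pderiv Q) x / poly Q x ^ Suc n"
      using that by (cases n) (simp_all add: divide_simps, simp_all add: algebra_simps)
    finally show ?thesis .
  qed
  have "Ck_on k U (\<lambda>p. poly P (p $ i) / poly Q (p $ i) ^ n)" for k n P
  proof (induction k arbitrary: n P)
    case 0
    then show ?case using Q by (auto intro!: continuous_intros)
  next
    case (Suc k)
    have "(\<lambda>p. poly P (p $ i) / poly Q (p $ i) ^ n) differentiable (at p)" if "p \<in> U" for p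
    proof -
      have "((\<lambda>p. p $ i) has_derivative (\<lambda>p. p $ i)) (at p)"
        by (rule bounded_linear_imp_has_derivative) (rule bounded_linear_vec_nth)
      from has_derivative_compose[OF this der[OF Q[OF that], of P n, unfolded has_field_derivative_def]]
      show ?thesis unfolding differentiable_def by blast
    qed
    moreover have "Ck_on k U (partial_deriv j (\<lambda>p. poly P (p $ i) / poly Q (p $ i) ^ n))" for j
    proof (cases "j = i")
      case True
      have "partial_deriv j (\<lambda>p. poly P (p $ i) / poly Q (p $ i) ^ n) p =
          poly (pderiv P * Q - of_nat n * P * pderiv Q) (p $ i) / poly Q (p $ i) ^ Suc n"
        if "p \<in> U" for p
        using DERIV_imp_deriv[OF der[OF Q[OF that], of P n]] True
          deriv_shift_0[of "\<lambda>x. poly P x / poly Q x ^ n" "p $ i"]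
        by (simp add: partial_deriv_def axis_def)
      then show ?thesis
        by (intro Ck_on_cong[OF U _ Suc.IH]) (rule sym)
    next
      case False
      have "partial_deriv j (\<lambda>p. poly P (p $ i) / poly Q (p $ i) ^ n) = (\<lambda>p. poly 0 (p $ i) / poly Q (p $ i) ^ 0)"
        using False by (simp add: partial_deriv_def axis_def fun_eq_iff)
      then show ?thesis by (simp only: Suc.IH)
    qed
    ultimately show ?case by simp
  qed
  \<comment> \<open>The fraction itself is the case \<open>n = 1\<close>.\<close>
  from this[of _ _ 1] show ?thesis by (simp add: smooth_on_def)
qed

section \<open>From components to vector fields\<close>

lemma sum_rotate:
  fixes T :: "'a \<Rightarrow> 'a \<Rightarrow> 'a \<Rightarrow> real"
  shows "(\<Sum>m\<in>A. \<Sum>i\<in>A. \<Sum>j\<in>A. T m i j) = (\<Sum>m\<in>A. \<Sum>i\<in>A. \<Sum>j\<in>A. T j m i)"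
proof -
  have "(\<Sum>m\<in>A. \<Sum>i\<in>A. \<Sum>j\<in>A. T j m i) = (\<Sum>m\<in>A. \<Sum>j\<in>A. \<Sum>i\<in>A. T j m i)"
    by (intro sum.cong refl sum.swap)
  also have "\<dots> = (\<Sum>j\<in>A. \<Sum>m\<in>A. \<Sum>i\<in>A. T j m i)" by (rule sum.swap)
  finally show ?thesis by simp
qed

text \<open>
  Permuting the arguments of a trilinear form cyclically permutes its indices the other way, and
  the sum over all three rotations does not see the difference.
\<close>

lemma cyclic_sum_trilinear:
  fixes T :: "'n::finite \<Rightarrow> 'n \<Rightarrow> 'n \<Rightarrow> real" and x y z :: "real ^ 'n"
  shows "cyclic_sum (\<lambda>x y z. \<Sum>m\<in>UNIV. \<Sum>i\<in>UNIV. \<Sum>j\<in>UNIV. T m i j * (x $ m * y $ i * z $ j)) x y z =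
    (\<Sum>m\<in>UNIV. \<Sum>i\<in>UNIV. \<Sum>j\<in>UNIV. cyclic_sum T m i j * (x $ m * y $ i * z $ j))"
proof -
  have "(\<Sum>m\<in>UNIV. \<Sum>i\<in>UNIV. \<Sum>j\<in>UNIV. T m i j * (y $ m * z $ i * x $ j)) =
     (\<Sum>m\<in>UNIV. \<Sum>i\<in>UNIV. \<Sum>j\<in>UNIV. T i j m * (x $ m * y $ i * z $ j))"
    by (subst (2) sum_rotate, simp add: mult_ac)
  moreover have "(\<Sum>m\<in>UNIV. \<Sum>i\<in>UNIV. \<Sum>j\<in>UNIV. T m i j * (z $ m * x $ i * y $ j)) =
     (\<Sum>m\<in>UNIV. \<Sum>i\<in>UNIV. \<Sum>j\<in>UNIV. T j m i * (x $ m * y $ i * z $ j))"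
    by (subst sum_rotate, simp add: mult_ac)
  ultimately show ?thesis
    by (simp add: cyclic_sum_def sum.distrib distrib_right)
qed

lemma eval5_trilinear:
  "eval5 T p x y z u v = (\<Sum>m\<in>UNIV. \<Sum>i\<in>UNIV. \<Sum>j\<in>UNIV.
     (\<Sum>k\<in>UNIV. \<Sum>l\<in>UNIV. T p m i j k l * u $ k * v $ l) * (x $ m * y $ i * z $ j))"
  unfolding eval5_def by (simp add: sum_distrib_left sum_distrib_right mult_ac)

lemma eval1_eval4:
  "eval1 \<sigma> p x * eval4 B p y z u v = eval5 (\<lambda>p m i j k l. \<sigma> p m * B p i j k l) p x y z u v"
  unfolding eval5_def eval1_def eval4_def sum_distrib_right[of "\<lambda>m. \<sigma> p m * x $ m"]
  by (simp add: sum_distrib_left mult_ac)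

text \<open>
  Recurrence is a pointwise multilinear identity; the difference of its two sides is stated as a
  single trilinear form so that its antisymmetry can be exploited.
\<close>

lemma recurrent_curvature_two_formsI:
  fixes g :: "'n::finite metric"
  assumes "smooth_one_form U \<sigma>"
    and "\<And>p m i j k l. p \<in> U \<Longrightarrow>
      cyclic_sum (\<lambda>m i j. nabla g B p m i j k l - \<sigma> p m * B p i j k l) m i j = 0"
  shows "recurrent_curvature_two_forms g B U"
proof -
  have eq: "cyclic_sum (\<lambda>m i j. \<Sum>k\<in>UNIV. \<Sum>l\<in>UNIV. nabla g B p m i j k l * u k * v l) m i j
     = cyclic_sum (\<lambda>m i j. \<Sum>k\<in>UNIV. \<Sum>l\<in>UNIV. \<sigma> p m * B p i j k l * u k * v l) m i j"
    if "p \<in> U" for p m i j u v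
  proof -
    have *: "nabla g B p m i j k l + nabla g B p i j m k l + nabla g B p j m i k l
      = \<sigma> p m * B p i j k l + \<sigma> p i * B p j m k l + \<sigma> p j * B p m i k l" for k l
      using assms(2)[OF that, of k l m i j] by (simp add: cyclic_sum_def)
    show ?thesis
      unfolding cyclic_sum_def by (simp only: sum.distrib[symmetric] distrib_right[symmetric] *)
  qed
  have "cyclic_sum (eval5_at (nabla g B)) x y z = cyclic_sum (eval5_at (\<lambda>p m i j k l. \<sigma> p m * B p i j k l)) x y z"
    if "p \<in> U" "eval5_at = (\<lambda>T x y z. eval5 T p x y z u v)" for p u v x y z and
     eval5_at :: "'n tensor05 \<Rightarrow> real ^ 'n \<Rightarrow> real ^ 'n \<Rightarrow> real ^ 'n \<Rightarrow> real"
    unfolding that(2) eval5_trilinear cyclic_sum_trilinear eq[OF that(1)] ..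
  then show ?thesis
    unfolding recurrent_curvature_two_forms_def eval1_eval4 cyclic_sum_def
    using assms(1) by (intro exI[of _ \<sigma>]) blast
qed

text \<open>
  The cyclic sum of a form that is antisymmetric in its last two arguments is totally
  antisymmetric, so it is determined by increasing triples.
\<close>

lemma alternating_cyclic_sum_4:
  fixes T :: "4 \<Rightarrow> 4 \<Rightarrow> 4 \<Rightarrow> real"
  assumes alt: "\<And>m i j. T m j i = - T m i j"
    and "cyclic_sum T 1 2 3 = 0" "cyclic_sum T 1 2 4 = 0"
        "cyclic_sum T 1 3 4 = 0" "cyclic_sum T 2 3 4 = 0"
  shows "cyclic_sum T m i j = 0"
proof -
  have diag: "T m i i = 0" for m i using alt[of m i i] by simp
  have "\<forall>m i j. cyclic_sum T m i j = 0"
    using assms(2-5)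
    by (simp add: forall_4 cyclic_sum_def diag
     alt[of _ 1 2] alt[of _ 1 3] alt[of _ 1 4] alt[of _ 2 3] alt[of _ 2 4] alt[of _ 3 4])
  then show ?thesis by blast
qed

section \<open>Connection and curvature\<close>

lemma matrix_inv_diagonal:
  fixes d :: "'n::finite \<Rightarrow> real"
  assumes "\<And>i. d i \<noteq> 0"
  shows "matrix_inv (\<chi> i j. if i = j then d i else 0) = (\<chi> i j. if i = j then 1 / d i else 0)"
proof -
  let ?A = "(\<chi> i j. if i = j then d i else 0) :: real ^ 'n ^ 'n"
  let ?B = "(\<chi> i j. if i = j then 1 / d i else 0) :: real ^ 'n ^ 'n"
  have AB: "?A ** ?B = mat 1" and BA: "?B ** ?A = mat 1"
    using assms
    by (auto simp: matrix_matrix_mult_def mat_def vec_eq_iff if_distrib[of "\<lambda>x. x * _"] cong: if_cong)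
  then have "invertible ?A" unfolding invertible_def by blast
  then have "matrix_inv ?A ** ?A = mat 1" unfolding invertible_def matrix_inv_def
    by (rule someI2_ex) auto
  then have "matrix_inv ?A = matrix_inv ?A ** (?A ** ?B)" by (simp add: AB)
  also have "\<dots> = ?B" by (simp add: matrix_mul_assoc \<open>matrix_inv ?A ** ?A = mat 1\<close>)
  finally show ?thesis .
qed

locale rnds =
  fixes M e \<Lambda> :: real
begin

abbreviation f :: "real \<Rightarrow> real" where "f \<equiv> rnds_f M e \<Lambda>"

definition f' :: "real \<Rightarrow> real" where "f' r = 2 * M / r\<^sup>2 - 2 * e\<^sup>2 / r ^ 3 - 2 * \<Lambda> * r"

definition f'' :: "real \<Rightarrow> real" where "f'' r = - 4 * M / r ^ 3 + 6 * e\<^sup>2 / r ^ 4 - 2 * \<Lambda>"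

lemma DERIV_f: "r \<noteq> 0 \<Longrightarrow> (f has_field_derivative f' r) (at r)"
  unfolding rnds_f_def f'_def
  by (auto intro!: derivative_eq_intros simp: field_simps eval_nat_numeral)

lemma DERIV_f': "r \<noteq> 0 \<Longrightarrow> (f' has_field_derivative f'' r) (at r)"
  unfolding f''_def f'_def
  by (auto intro!: derivative_eq_intros simp: field_simps eval_nat_numeral)

abbreviation "g \<equiv> rnds_metric M e \<Lambda>"
abbreviation "chart \<equiv> rnds_chart M e \<Lambda>"

lemma open_rnds_chart: "open chart"
proof -
  \<comment> \<open>Clearing the denominator of \<open>f\<close> yields conditions that are continuous on the whole space.\<close>
  have eq: "f r \<noteq> 0 \<longleftrightarrow> r\<^sup>2 - 2 * M * r + e\<^sup>2 - \<Lambda> * r ^ 4 \<noteq> 0" if "0 < r" for r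
  proof -
    have "r\<^sup>2 - 2 * M * r + e\<^sup>2 - \<Lambda> * r ^ 4 = r\<^sup>2 * f r"
      using that by (simp add: rnds_f_def field_simps eval_nat_numeral)
    then show ?thesis using that by simp
  qed
  have "chart = {p. 0 < p $ 2} \<inter> {p. 0 < p $ 3} \<inter> {p. p $ 3 < pi} \<inter>
      {p. (p $ 2)\<^sup>2 - 2 * M * p $ 2 + e\<^sup>2 - \<Lambda> * (p $ 2) ^ 4 \<noteq> 0}"
    using eq by (auto simp: rnds_chart_def)
  also have "open \<dots>"
    by (intro open_Int open_Collect_less open_Collect_neq continuous_intros)
  finally show ?thesis .
qed

lemma rnds_chartD:
  assumes "p \<in> chart"
  shows "p $ 2 \<noteq> 0" "f (p $ 2) \<noteq> 0" "sin (p $ 3) \<noteq> 0"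
  using assms sin_gt_zero[of "p $ 3"] by (auto simp: rnds_chart_def)

text \<open>
  All tensor components of RNdS depend on \<open>(r, \<theta>)\<close> only, but closed forms for them are available only
  on the chart; since the chart is open, derivatives of the closed forms are what is needed.
\<close>

lemma partial_deriv_chart:
  assumes "p \<in> chart" and "\<And>q. q \<in> chart \<Longrightarrow> B q = F (q $ 2) (q $ 3)"
    and "m = 2 \<Longrightarrow> ((\<lambda>r. F r (p $ 3)) has_field_derivative D) (at (p $ 2))"
    and "m = 3 \<Longrightarrow> (F (p $ 2) has_field_derivative D) (at (p $ 3))"
    and "m \<noteq> 2 \<Longrightarrow> m \<noteq> 3 \<Longrightarrow> D = 0"
  shows "partial_deriv m B p = D"
proof -
  have "partial_deriv m B p = partial_deriv m (\<lambda>q. F (q $ 2) (q $ 3)) p"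
    by (rule partial_deriv_cong[OF open_rnds_chart assms(1,2)])
  then show ?thesis
    unfolding partial_deriv_plane using assms(3-5) by (auto intro: DERIV_imp_deriv)
qed

text \<open>
  The diagonal coefficient \<open>g\<^sub>i\<^sub>i\<close>; below, \<open>dG m i\<close> is its derivative in the direction \<open>m\<close>.
\<close>

definition G :: "4 \<Rightarrow> real \<Rightarrow> real \<Rightarrow> real" where
  "G i r \<theta> = (if i = 1 then - f r else if i = 2 then 1 / f r else if i = 3 then r\<^sup>2 else r\<^sup>2 * (sin \<theta>)\<^sup>2)"

definition dG :: "4 \<Rightarrow> 4 \<Rightarrow> real \<Rightarrow> real \<Rightarrow> real" where
  "dG m i r \<theta> = (if m = 2 then (if i = 1 then - f' r else if i = 2 then - f' r / (f r)\<^sup>2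
       else if i = 3 then 2 * r else 2 * r * (sin \<theta>)\<^sup>2) else if m = 3 \<and> i = 4 then 2 * r\<^sup>2 * sin \<theta> * cos \<theta> else 0)"

lemma rnds_metric_diagonal:
  "g p = (\<chi> i j. if i = j then G i (p $ 2) (p $ 3) else 0)"
  by (auto simp: rnds_metric_def G_def vec_eq_iff)

lemma DERIV_G_r:
  assumes "r \<noteq> 0" "f r \<noteq> 0"
  shows "((\<lambda>r. G i r \<theta>) has_field_derivative dG 2 i r \<theta>) (at r)"
  using exhaust_4[of i] assms
  by (elim disjE)
    (auto simp: G_def dG_def power2_eq_square field_simps intro!: derivative_eq_intros DERIV_f)

lemma DERIV_G_\<theta>: "(G i r has_field_derivative dG 3 i r \<theta>) (at \<theta>)"
  using exhaust_4[of i]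
  by (elim disjE)
    (auto simp: G_def[abs_def] dG_def power2_eq_square field_simps intro!: derivative_eq_intros)

lemma partial_deriv_rnds_metric:
  assumes "p \<in> chart"
  shows "partial_deriv m (\<lambda>q. g q $ i $ j) p = (if i = j then dG m i (p $ 2) (p $ 3) else 0)"
proof (cases "i = j")
  case True
  then show ?thesis
   using rnds_chartD[OF assms] DERIV_G_r DERIV_G_\<theta>
    by (intro partial_deriv_chart[OF assms, where F = "G i"])
       (auto simp: rnds_metric_diagonal dG_def)
next
  case False
  then show ?thesis by (simp add: rnds_metric_def partial_deriv_def)
qed

lemma inv_metric_rnds:
  assumes "p \<in> chart"
  shows "inv_metric g p = (\<chi> i j. if i = j then 1 / G i (p $ 2) (p $ 3) else 0)"
  unfolding inv_metric_def rnds_metric_diagonal using rnds_chartD[OF assms]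
  by (intro matrix_inv_diagonal) (simp add: G_def)

text \<open>
  The Christoffel symbols \<open>\<Gamma>\<^sup>k\<^sub>i\<^sub>j\<close>; below, \<open>d\<Gamma> m k i j\<close> is the derivative in the direction \<open>m\<close>.
\<close>

definition \<Gamma> :: "4 \<Rightarrow> 4 \<Rightarrow> 4 \<Rightarrow> real \<Rightarrow> real \<Rightarrow> real" where
  "\<Gamma> k i j r \<theta> =
    (if k = 1 then (if i = 1 \<and> j = 2 \<or> i = 2 \<and> j = 1 then f' r / (2 * f r) else 0)
     else if k = 2 then (if i \<noteq> j then 0 else if i = 1 then f r * f' r / 2
          else if i = 2 then - f' r / (2 * f r) else if i = 3 then - r * f r else - r * f r * (sin \<theta>)\<^sup>2)
     else if k = 3 then (if i = 2 \<and> j = 3 \<or> i = 3 \<and> j = 2 then 1 / r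
          else if i = 4 \<and> j = 4 then - sin \<theta> * cos \<theta> else 0)
     else (if i = 2 \<and> j = 4 \<or> i = 4 \<and> j = 2 then 1 / r
          else if i = 3 \<and> j = 4 \<or> i = 4 \<and> j = 3 then cos \<theta> / sin \<theta> else 0))"

definition d\<Gamma> :: "4 \<Rightarrow> 4 \<Rightarrow> 4 \<Rightarrow> 4 \<Rightarrow> real \<Rightarrow> real \<Rightarrow> real" where
  "d\<Gamma> m k i j r \<theta> =
    (if m = 2 then
    (if k = 1 then (if i = 1 \<and> j = 2 \<or> i = 2 \<and> j = 1 then (f'' r * f r - (f' r)\<^sup>2) / (2 * (f r)\<^sup>2) else 0)
     else if k = 2 then (if i \<noteq> j then 0 else if i = 1 then ((f' r)\<^sup>2 + f r * f'' r) / 2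
          else if i = 2 then - (f'' r * f r - (f' r)\<^sup>2) / (2 * (f r)\<^sup>2)
          else if i = 3 then - f r - r * f' r else (- f r - r * f' r) * (sin \<theta>)\<^sup>2)
     else if k = 3 then (if i = 2 \<and> j = 3 \<or> i = 3 \<and> j = 2 then - 1 / r\<^sup>2 else 0)
     else (if i = 2 \<and> j = 4 \<or> i = 4 \<and> j = 2 then - 1 / r\<^sup>2 else 0))
    else if m = 3 then
      (if k = 2 \<and> i = 4 \<and> j = 4 then - 2 * r * f r * sin \<theta> * cos \<theta>
       else if k = 3 \<and> i = 4 \<and> j = 4 then (sin \<theta>)\<^sup>2 - (cos \<theta>)\<^sup>2
       else if k = 4 \<and> (i = 3 \<and> j = 4 \<or> i = 4 \<and> j = 3) then - 1 / (sin \<theta>)\<^sup>2 else 0)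
    else 0)"

lemma DERIV_\<Gamma>_r:
  assumes "r \<noteq> 0" "f r \<noteq> 0"
  shows "((\<lambda>r. \<Gamma> k i j r \<theta>) has_field_derivative d\<Gamma> 2 k i j r \<theta>) (at r)"
  using exhaust_4[of k] exhaust_4[of i] exhaust_4[of j] assms
  by (elim disjE)
    (auto simp: \<Gamma>_def d\<Gamma>_def power2_eq_square field_simps intro!: derivative_eq_intros DERIV_f DERIV_f')

lemma DERIV_\<Gamma>_\<theta>:
  assumes "sin \<theta> \<noteq> 0"
  shows "(\<Gamma> k i j r has_field_derivative d\<Gamma> 3 k i j r \<theta>) (at \<theta>)"
proof -
  have cot: "((\<lambda>\<theta>. cos \<theta> / sin \<theta>) has_field_derivative - 1 / (sin \<theta>)\<^sup>2) (at \<theta>)"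
  proof -
    have "- sin \<theta> * sin \<theta> - cos \<theta> * cos \<theta> = - 1"
      using sin_cos_squared_add[of \<theta>] by (simp add: power2_eq_square)
    then show ?thesis
      using DERIV_divide[OF DERIV_cos DERIV_sin assms] by (simp add: power2_eq_square)
  qed
  show ?thesis
  using exhaust_4[of k] exhaust_4[of i] exhaust_4[of j] cot
  by (elim disjE)
    (auto simp: \<Gamma>_def[abs_def] d\<Gamma>_def power2_eq_square algebra_simps intro!: derivative_eq_intros)
qed

text \<open>
  For a diagonal metric the sum over the raised index has one term, and each of the three
  derivatives of the metric contributes only when two of the indices coincide.
\<close>

lemma christoffel_rnds:
  assumes "p \<in> chart"
  shows "christoffel g p k i j = \<Gamma> k i j (p $ 2) (p $ 3)"
proof -
  have "christoffel g p k i j = ((if j = k then dG i k (p $ 2) (p $ 3) else 0) + (if i = k then dG j k (p $ 2) (p $ 3) else 0)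
    - (if i = j then dG k i (p $ 2) (p $ 3) else 0)) / (2 * G k (p $ 2) (p $ 3))"
    unfolding christoffel_def partial_deriv_rnds_metric[OF assms] inv_metric_rnds[OF assms]
    by (simp add: if_distrib[of "\<lambda>x. x * _"] cong: if_cong)
  also have "\<dots> = \<Gamma> k i j (p $ 2) (p $ 3)"
    using rnds_chartD[OF assms] exhaust_4[of k] exhaust_4[of i] exhaust_4[of j]
    by (elim disjE) (simp_all add: G_def dG_def \<Gamma>_def power2_eq_square)
  finally show ?thesis .
qed

lemma partial_deriv_christoffel_rnds:
  assumes "p \<in> chart"
  shows "partial_deriv m (\<lambda>q. christoffel g q k i j) p = d\<Gamma> m k i j (p $ 2) (p $ 3)"
  using rnds_chartD[OF assms] DERIV_\<Gamma>_r DERIV_\<Gamma>_\<theta>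
  by (intro partial_deriv_chart[OF assms, where F = "\<Gamma> k i j"])
     (auto simp: christoffel_rnds d\<Gamma>_def)

text \<open>
  The sectional curvature of the coordinate plane spanned by directions \<open>i\<close> and \<open>j\<close>.  On the diagonal
  \<open>i = j\<close> it has an arbitrary value, because \<open>K i j\<close> is always multiplied by an expression that is
  antisymmetric in \<open>i\<close> and \<open>j\<close>.
\<close>

definition K :: "4 \<Rightarrow> 4 \<Rightarrow> real \<Rightarrow> real" where
  "K i j r = (if i \<in> {1, 2} \<and> j \<in> {1, 2} then - f'' r / 2
     else if i \<in> {3, 4} \<and> j \<in> {3, 4} then (1 - f r) / r\<^sup>2 else - (f' r / r) / 2)"

text \<open>
  Each \<open>R(\<partial>\<^sub>i, \<partial>\<^sub>j)\<close> is a multiple of the infinitesimal rotation of the plane of \<open>\<partial>\<^sub>i\<close> and \<open>\<partial>\<^sub>j\<close>: the static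
  and the spherical symmetry leave no off-diagonal curvature.
\<close>

lemma riemann_endo_rnds:
  assumes "p \<in> chart"
  shows "riemann_endo g p l k i j = K i j (p $ 2) * ((if l = i then g p $ j $ k else 0) - (if l = j then g p $ i $ k else 0))"
proof -
  \<comment> \<open>The only trigonometric relation that is used, in the normal form that \<open>algebra_simps\<close> produces.\<close>
  have trig: "cos \<theta> * (cos \<theta> * (sin \<theta> * sin \<theta>)) + sin \<theta> * (sin \<theta> * (sin \<theta> * sin \<theta>))
      = sin \<theta> * sin \<theta>" for \<theta> :: real
  proof -
    have "cos \<theta> * (cos \<theta> * (sin \<theta> * sin \<theta>)) + sin \<theta> * (sin \<theta> * (sin \<theta> * sin \<theta>))
      = sin \<theta> * sin \<theta> * ((sin \<theta>)\<^sup>2 + (cos \<theta>)\<^sup>2)"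
      by (simp only: algebra_simps power2_eq_square)
    then show ?thesis by simp
  qed
  have "\<forall>l k i j. riemann_endo g p l k i j = K i j (p $ 2) *
      ((if l = i then g p $ j $ k else 0) - (if l = j then g p $ i $ k else 0))"
    unfolding riemann_endo_def partial_deriv_christoffel_rnds[OF assms]
      christoffel_rnds[OF assms] rnds_metric_diagonal forall_4 sum_4
    using rnds_chartD[OF assms]
    by (simp add: \<Gamma>_def d\<Gamma>_def K_def G_def, simp add: divide_simps,
        simp add: power2_eq_square algebra_simps trig)
  then show ?thesis by blast
qed

lemma riemann_rnds:
  assumes "p \<in> chart"
  shows "riemann g p i j k l = K i j (p $ 2) * (g p $ i $ l * g p $ j $ k - g p $ j $ l * g p $ i $ k)"
proof -
  have "riemann_endo g p m k i j * g p $ m $ l = K i j (p $ 2) *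
      ((if m = i then g p $ m $ l * g p $ j $ k else 0) - (if m = j then g p $ m $ l * g p $ i $ k else 0))" for m
    by (simp add: riemann_endo_rnds[OF assms])
  then show ?thesis
    by (simp add: riemann_def sum_distrib_left[symmetric] sum_subtractf)
qed

text \<open>
  The eigenvalues of the Ricci tensor: \<open>\<rho> j\<close> is the sum of the sectional curvatures of the three
  coordinate planes that contain \<open>\<partial>\<^sub>j\<close>.
\<close>

definition \<rho> :: "4 \<Rightarrow> real \<Rightarrow> real" where
  "\<rho> j r = (if j \<in> {1, 2} then - f'' r / 2 - f' r / r else (1 - f r) / r\<^sup>2 - f' r / r)"

lemma ricci_rnds:
  assumes "p \<in> chart"
  shows "ricci g p j k = \<rho> j (p $ 2) * g p $ j $ k"
proof -
  have "ricci g p j k = (\<Sum>i\<in>UNIV. if i = j then 0 else K i j (p $ 2)) * g p $ j $ k"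
    unfolding ricci_def sum_distrib_right
    by (intro sum.cong) (simp_all add: riemann_endo_rnds[OF assms])
  also have "(\<Sum>i\<in>UNIV. if i = j then 0 else K i j r) = \<rho> j r" for r
    using exhaust_4[of j] by (elim disjE) (simp_all add: sum_4 K_def \<rho>_def)
  finally show ?thesis .
qed

lemma scalar_curvature_rnds:
  assumes "p \<in> chart"
  shows "scalar_curvature g p = (\<Sum>j\<in>UNIV. \<rho> j (p $ 2))"
proof -
  have "inv_metric g p $ j $ k * ricci g p j k = (if k = j then \<rho> j (p $ 2) else 0)" for j k
    using rnds_chartD[OF assms]
    by (simp add: ricci_rnds[OF assms] inv_metric_rnds[OF assms] rnds_metric_diagonal G_def)
  then show ?thesis by (simp add: scalar_curvature_def)
qed

section \<open>The Weyl tensor\<close>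

definition w :: "real \<Rightarrow> real" where "w r = 2 * (M * r - e\<^sup>2) / r ^ 4"

definition w' :: "real \<Rightarrow> real" where "w' r = 8 * e\<^sup>2 / r ^ 5 - 6 * M / r ^ 4"

lemma DERIV_w: "r \<noteq> 0 \<Longrightarrow> (w has_field_derivative w' r) (at r)"
  unfolding w_def[abs_def] w'_def
  by (auto intro!: derivative_eq_intros simp: divide_simps) (simp add: algebra_simps eval_nat_numeral)

text \<open>
  The factor of \<open>w\<close> in the Weyl eigenvalue of a coordinate plane.  Vanishing of the trace over the
  three planes through a given direction, one pure and two mixed, forces the ratio \<open>1 : - 1 / 2\<close>.
\<close>

definition \<kappa> :: "4 \<Rightarrow> 4 \<Rightarrow> real" where
  "\<kappa> i j = (if i \<in> {1, 2} \<longleftrightarrow> j \<in> {1, 2} then 1 else - 1 / 2)"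

lemma \<kappa>_commute: "\<kappa> j i = \<kappa> i j"
  by (auto simp: \<kappa>_def)

text \<open>
  This is where the form of \<open>f\<close> enters.  All Weyl eigenvalues are multiples of
  \<open>(1 - f) / r\<^sup>2 - f'' / 2 + f' / r\<close>, which is affine in \<open>f\<close> and vanishes for the de Sitter
  function \<open>1 - \<Lambda> r\<^sup>2\<close>; only the mass and charge terms of \<open>f\<close> are left.
\<close>

lemma weyl_eigenvalue:
  assumes "r \<noteq> 0" "i \<noteq> j"
  shows "K i j r - (\<rho> i r + \<rho> j r) / 2 + (\<Sum>j\<in>UNIV. \<rho> j r) / 6 = \<kappa> i j * w r"
proof -
  have w: "w r = ((1 - f r) / r\<^sup>2 - f'' r / 2 + f' r / r) / 3"
    using assms(1) by (simp add: rnds_f_def f'_def f''_def w_def field_simps eval_nat_numeral)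
  \<comment> \<open>With \<open>a\<close>, \<open>b\<close>, \<open>c\<close> opaque, what remains in each case is linear arithmetic.\<close>
  have "K i j r - (\<rho> i r + \<rho> j r) / 2 + (\<Sum>j\<in>UNIV. \<rho> j r) / 6 = \<kappa> i j * ((a + c + b) / 3)"
    if "a = (1 - f r) / r\<^sup>2" "b = f' r / r" "c = - f'' r / 2" for a b c
    using exhaust_4[of i] exhaust_4[of j] assms(2)
    unfolding K_def \<rho>_def \<kappa>_def that[symmetric]
    by (elim disjE; simp only: sum_4; simp add: add_divide_distrib diff_divide_distrib)
  from this[OF refl refl refl] show ?thesis
    unfolding w by (simp add: diff_divide_distrib)
qed

definition A :: "4 \<Rightarrow> 4 \<Rightarrow> real \<Rightarrow> real \<Rightarrow> real" where
  "A i j r \<theta> = \<kappa> i j * w r * (G i r \<theta> * G j r \<theta>)"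

text \<open>
  The identity on bivectors in coordinate components, in the index order of the Weyl tensor; it is
  independent of the metric, which is why \<open>A i j\<close> carries the factor \<open>G i * G j\<close>.
\<close>

definition bivector_id :: "4 \<Rightarrow> 4 \<Rightarrow> 4 \<Rightarrow> 4 \<Rightarrow> real" where
  "bivector_id i j k l = (if i = l \<and> j = k then 1 else 0) - (if i = k \<and> j = l then 1 else 0)"

lemma bivector_id_swap: "bivector_id j i k l = - bivector_id i j k l"
  unfolding bivector_id_def by (simp add: conj_commute)

lemma weyl_rnds:
  assumes "p \<in> chart"
  shows "weyl g p i j k l = A i j (p $ 2) (p $ 3) * bivector_id i j k l"
proof -
  have "weyl g p i j k l = (K i j (p $ 2) - (\<rho> i (p $ 2) + \<rho> j (p $ 2)) / 2 + (\<Sum>j\<in>UNIV. \<rho> j (p $ 2)) / 6)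
     * (g p $ i $ l * g p $ j $ k - g p $ j $ l * g p $ i $ k)"
    unfolding weyl_def kulkarni_nomizu_def riemann_rnds[OF assms] ricci_rnds[OF assms]
      scalar_curvature_rnds[OF assms]
    by (simp add: algebra_simps add_divide_distrib diff_divide_distrib)
  also have "g p $ i $ l * g p $ j $ k - g p $ j $ l * g p $ i $ k
      = G i (p $ 2) (p $ 3) * G j (p $ 2) (p $ 3) * bivector_id i j k l"
    unfolding rnds_metric_diagonal bivector_id_def
    by (cases "i = l"; cases "j = k"; cases "i = k"; cases "j = l"; simp)
  finally have eq: "weyl g p i j k l = (K i j (p $ 2) - (\<rho> i (p $ 2) + \<rho> j (p $ 2)) / 2
      + (\<Sum>j\<in>UNIV. \<rho> j (p $ 2)) / 6)
      * (G i (p $ 2) (p $ 3) * G j (p $ 2) (p $ 3) * bivector_id i j k l)" .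
  show ?thesis
  proof (cases "i = j")
    case True
    then have "bivector_id i j k l = 0" using bivector_id_swap[of j i k l] by simp
    then show ?thesis by (simp add: eq)
  next
    case False
    then show ?thesis
      unfolding eq weyl_eigenvalue[OF rnds_chartD(1)[OF assms] False] by (simp add: A_def)
  qed
qed

definition dA :: "4 \<Rightarrow> 4 \<Rightarrow> 4 \<Rightarrow> real \<Rightarrow> real \<Rightarrow> real" where
  "dA m i j r \<theta> = \<kappa> i j * (if m = 2 then w' r else 0) * (G i r \<theta> * G j r \<theta>)
     + \<kappa> i j * w r * (dG m i r \<theta> * G j r \<theta> + G i r \<theta> * dG m j r \<theta>)"

lemma partial_deriv_weyl_rnds:
  assumes "p \<in> chart"
  shows "partial_deriv m (\<lambda>q. weyl g q i j k l) p = dA m i j (p $ 2) (p $ 3) * bivector_id i j k l"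
proof (rule partial_deriv_chart[OF assms])
  show "weyl g q i j k l = (\<lambda>r \<theta>. A i j r \<theta> * bivector_id i j k l) (q $ 2) (q $ 3)" if "q \<in> chart" for q
    using weyl_rnds[OF that] .
  note D = rnds_chartD[OF assms]
  show "((\<lambda>r. A i j r (p $ 3) * bivector_id i j k l) has_field_derivative
      dA m i j (p $ 2) (p $ 3) * bivector_id i j k l) (at (p $ 2))" if "m = 2"
    unfolding A_def
    by (rule DERIV_cong[OF DERIV_cmult_right[OF DERIV_mult[OF DERIV_cmult[OF DERIV_w[OF D(1)]]
          DERIV_mult[OF DERIV_G_r[OF D(1,2)] DERIV_G_r[OF D(1,2)]]]]])
      (simp add: dA_def that algebra_simps)
  show "((\<lambda>\<theta>. A i j (p $ 2) \<theta> * bivector_id i j k l) has_field_derivative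
      dA m i j (p $ 2) (p $ 3) * bivector_id i j k l) (at (p $ 3))" if "m = 3"
    unfolding A_def
    by (rule DERIV_cong[OF DERIV_cmult_right[OF DERIV_cmult[OF DERIV_mult[OF DERIV_G_\<theta> DERIV_G_\<theta>]]]])
      (simp add: dA_def that algebra_simps)
qed (simp add: dA_def dG_def)

lemma weyl_rnds_antisym:
  assumes "p \<in> chart"
  shows "weyl g p j i k l = - weyl g p i j k l"
  by (simp add: weyl_rnds[OF assms] A_def bivector_id_swap[of j i] \<kappa>_commute[of j i])

lemma nabla_weyl_rnds_antisym:
  assumes "p \<in> chart"
  shows "nabla g (weyl g) p m j i k l = - nabla g (weyl g) p m i j k l"
proof -
  have 1: "partial_deriv m (\<lambda>q. weyl g q j i k l) p = - partial_deriv m (\<lambda>q. weyl g q i j k l) p"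
    by (simp add: partial_deriv_weyl_rnds[OF assms] dA_def bivector_id_swap[of j i] \<kappa>_commute[of j i] algebra_simps)
  have swap: "(\<Sum>s\<in>UNIV. a s * weyl g p (x s) (y s) (u s) (v s)) = - (\<Sum>s\<in>UNIV. a s * weyl g p (y s) (x s) (u s) (v s))"
    for a :: "4 \<Rightarrow> real" and x y u v
    unfolding sum_negf[symmetric] by (intro sum.cong refl) (simp add: weyl_rnds_antisym[OF assms, of "x _" "y _"])
  show ?thesis
    unfolding nabla_def 1
     swap[of _ "\<lambda>_. j" "\<lambda>_. i"] swap[of _ "\<lambda>s. s" "\<lambda>_. i"] swap[of _ "\<lambda>_. j" "\<lambda>s. s"] by simp
qed

section \<open>The recurrence form\<close>

abbreviation "regular_chart \<equiv> rnds_regular_chart M e \<Lambda>"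

definition \<sigma> :: "4 one_form" where
  "\<sigma> p m = (if m = 2 then e\<^sup>2 / (p $ 2 * (M * p $ 2 - e\<^sup>2)) else 0)"

lemma smooth_\<sigma>: "smooth_one_form regular_chart \<sigma>"
proof -
  have U: "open regular_chart"
  proof -
    have "regular_chart = chart \<inter> {p. M * p $ 2 \<noteq> e\<^sup>2}" by (auto simp: rnds_regular_chart_def)
    then show ?thesis using open_rnds_chart
      by (auto intro!: open_Int open_Collect_neq continuous_intros)
  qed
  have "smooth_on regular_chart (\<lambda>p. \<sigma> p m)" for m
  proof -
    have "smooth_on regular_chart (\<lambda>p. poly [:if m = 2 then e\<^sup>2 else 0:] (p $ 2) / poly [:0, - e\<^sup>2, M:] (p $ 2))"
      by (rule smooth_on_rational[OF U])
        (auto simp: rnds_regular_chart_def rnds_chart_def algebra_simps)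
    also have "(\<lambda>p :: real ^ 4. poly [:if m = 2 then e\<^sup>2 else 0:] (p $ 2) / poly [:0, - e\<^sup>2, M:] (p $ 2)) = (\<lambda>p. \<sigma> p m)"
      by (auto simp: \<sigma>_def fun_eq_iff algebra_simps)
    finally show ?thesis .
  qed
  then show ?thesis by (simp add: smooth_one_form_def)
qed

text \<open>
  Multiplying by \<open>w\<close> cancels the denominator \<open>M r - e\<^sup>2\<close> of \<open>\<sigma>\<close>.  The right-hand side is the coefficient
  that covariant differentiation produces: \<open>w'\<close> from the eigenvalue and \<open>3 w / r\<close> from the warping.
\<close>

lemma \<sigma>_times_w:
  assumes "p \<in> regular_chart"
  shows "\<sigma> p m * w (p $ 2) = (if m = 2 then w' (p $ 2) + 3 * w (p $ 2) / p $ 2 else 0)"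
  using assms by (auto simp: \<sigma>_def w_def w'_def rnds_regular_chart_def rnds_chart_def field_simps eval_nat_numeral)

lemma cyclic_nabla_weyl_rnds:
  assumes "p \<in> regular_chart"
  shows "cyclic_sum (\<lambda>m i j. nabla g (weyl g) p m i j k l - \<sigma> p m * weyl g p i j k l) m i j = 0"
proof (rule alternating_cyclic_sum_4)
  have p: "p \<in> chart" using assms by (simp add: rnds_regular_chart_def)
  note D = rnds_chartD[OF p]
  show "nabla g (weyl g) p m j i k l - \<sigma> p m * weyl g p j i k l =
     - (nabla g (weyl g) p m i j k l - \<sigma> p m * weyl g p i j k l)" for m i j
    by (simp add: nabla_weyl_rnds_antisym[OF p, of m j i] weyl_rnds_antisym[OF p, of j i])
  have \<sigma>: "\<sigma> p m * A i j r \<theta> = (if m = 2 then \<kappa> i j * (w' r + 3 * w r / r) * (G i r \<theta> * G j r \<theta>) else 0)"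
    if "r = p $ 2" for m i j r \<theta>
  proof -
    have "\<sigma> p m * A i j r \<theta> = \<kappa> i j * (\<sigma> p m * w (p $ 2)) * (G i r \<theta> * G j r \<theta>)"
      by (simp add: A_def that)
    then show ?thesis unfolding \<sigma>_times_w[OF assms] that by simp
  qed
  define r where "r = p $ 2"
  define \<theta> where "\<theta> = p $ 3"
  \<comment> \<open>The term with \<open>\<sigma>\<close> joins the derivative term, which frees the identity of the denominator \<open>M r - e\<^sup>2\<close>.\<close>
  have T: "nabla g (weyl g) p m i j k l - \<sigma> p m * weyl g p i j k l =
    (dA m i j r \<theta> - (if m = 2 then \<kappa> i j * (w' r + 3 * w r / r) * (G i r \<theta> * G j r \<theta>) else 0)) * bivector_id i j k l
     - (\<Sum>s\<in>UNIV. \<Gamma> s m i r \<theta> * (A s j r \<theta> * bivector_id s j k l))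
     - (\<Sum>s\<in>UNIV. \<Gamma> s m j r \<theta> * (A i s r \<theta> * bivector_id i s k l))
     - (\<Sum>s\<in>UNIV. \<Gamma> s m k r \<theta> * (A i j r \<theta> * bivector_id i j s l))
     - (\<Sum>s\<in>UNIV. \<Gamma> s m l r \<theta> * (A i j r \<theta> * bivector_id i j k s))" for m i j
    unfolding nabla_def christoffel_rnds[OF p] weyl_rnds[OF p] partial_deriv_weyl_rnds[OF p]
       r_def \<theta>_def left_diff_distrib \<sigma>[symmetric, OF refl] mult.assoc[of "\<sigma> p m"] by simp
  note D' = D[folded r_def \<theta>_def]
  let ?T = "\<lambda>m i j. nabla g (weyl g) p m i j k l - \<sigma> p m * weyl g p i j k l"
  \<comment> \<open>\<open>f\<close>, \<open>f'\<close>, \<open>w\<close> and \<open>w'\<close> stay opaque: the identity holds as one of rational functions in them.\<close>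
  have "cyclic_sum ?T 1 2 3 = 0 \<and> cyclic_sum ?T 1 2 4 = 0 \<and> cyclic_sum ?T 1 3 4 = 0 \<and> cyclic_sum ?T 2 3 4 = 0"
    unfolding T cyclic_sum_def sum_4 using exhaust_4[of k] exhaust_4[of l] D'
    by (elim disjE; intro conjI; simp add: bivector_id_def;
        simp add: A_def dA_def \<Gamma>_def \<kappa>_def G_def dG_def;
        (simp add: divide_simps)?; (simp add: eval_nat_numeral algebra_simps)?)
  then show "cyclic_sum ?T 1 2 3 = 0" "cyclic_sum ?T 1 2 4 = 0" "cyclic_sum ?T 1 3 4 = 0" "cyclic_sum ?T 2 3 4 = 0"
    by simp_all
qed

end

theorem mainTheorem7:
  fixes M e \<Lambda> :: real
  assumes "e \<noteq> 0" and "\<Lambda> > 0"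
  shows "recurrent_conformal_two_forms (rnds_metric M e \<Lambda>) (rnds_regular_chart M e \<Lambda>)"
proof -
  interpret rnds M e \<Lambda> .
  show ?thesis
    unfolding recurrent_conformal_two_forms_def
    by (rule recurrent_curvature_two_formsI[OF smooth_\<sigma> cyclic_nabla_weyl_rnds])
qed

end
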